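(* The following series converges and $$\frac{1}{\pi} = \frac{1}{16} \sum_{n=0}^{+\infty} \frac{\big[(2n)!\big]^3}{(n!)^6}\, \frac{5 + 7\times 6\, n}{64^{2n}}.$$ *)

theory Defs
  imports "HOL-Analysis.Analysis"
begin

end

theory Submission
  imports Defs "HOL-Real_Asymp.Real_Asymp"
begin

text \<open>
  The series is the member \<open>k = 0\<close> of a family of series whose sum does not depend on \<open>k\<close>;
  as \<open>k\<close> grows, everything but the term \<open>n = 0\<close> dies out, and that term has a limit given
  by the asymptotics of the central binomial coefficient, which is where \<open>\<pi>\<close> comes from.

  The family is \<open>\<Sum>n. wz_term n k\<close>.  It arises by accelerating the well-poised series
  \<open>\<Sum>j. (-1)^j (a + 2j) (a)_j (1/2)_j^2 / (j! (a + 1/2)_j^2)\<close> at \<open>a = k + 1/2\<close>: repeatedly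
  replacing the parameters \<open>(a; a, 1/2, 1/2)\<close> by \<open>(a + 3; a + 1, 3/2, 3/2)\<close> turns it into a series
  whose terms decay like \<open>64^(-n)\<close>.  The polynomial \<open>wz_poly\<close> is what these replacements leave
  behind; it is determined by the Wilf-Zeilberger equation
  \<open>G n (k+1) - G n k = F (n+1) k - F n k\<close> with \<open>G = wz_term\<close> and \<open>F n k = 32 n * wz_kernel n k\<close>
  (\<open>wz_pair\<close>).  As \<open>F 0 k = 0\<close> and \<open>F n k\<close> tends to \<open>0\<close> in \<open>n\<close>, summation over \<open>n\<close> shows that the sum
  of the family is constant (\<open>suminf_wz_term_const\<close>).  A geometric bound on the kernel, with an
  additional factor \<open>(k + 2)^(-2)\<close> for \<open>n \<ge> 1\<close> (\<open>wz_kernel_le\<close>), gives all the convergence that is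
  needed.
\<close>

definition wz_kernel :: "nat \<Rightarrow> nat \<Rightarrow> real" where
  "wz_kernel n k = (pochhammer (1/2) (n + k) / fact (k + 2 * n))^2
                     * pochhammer (1/2) n ^ 4 / fact (2 * n)"

text \<open>At \<open>k = 0\<close> this is \<open>(42 n + 5) (2 n + 1)^2\<close>, the source of the linear factor in the
  series.\<close>

definition wz_poly :: "real \<Rightarrow> real \<Rightarrow> real" where
  "wz_poly n k = 16 * k^3 + 36 * k^2 + 24 * k + 5 + n * (104 * k^2 + 160 * k + 62)
                   + n^2 * (224 * k + 188) + 168 * n^3"

definition wz_term :: "nat \<Rightarrow> nat \<Rightarrow> real" where
  "wz_term n k = wz_kernel n k * wz_poly n k / (real k + 1 + 2 * real n)^2"

lemma wz_kernel_pos: "wz_kernel n k > 0"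
  using pochhammer_pos[of "1/2 :: real"]
  by (auto simp: wz_kernel_def intro!: divide_pos_pos mult_pos_pos zero_less_power)

lemma wz_kernel_Suc_right:
  "wz_kernel n (Suc k) = wz_kernel n k * ((real k + real n + 1/2) / (real k + 1 + 2 * real n))^2"
proof -
  have "pochhammer (1/2::real) (n + Suc k)
          = pochhammer (1/2) (n + k) * (real k + real n + 1/2)"
    by (simp add: pochhammer_Suc algebra_simps)
  moreover have "(fact (Suc k + 2 * n) :: real) = fact (k + 2 * n) * (real k + 1 + 2 * real n)"
    by (simp add: algebra_simps)
  ultimately show ?thesis
    unfolding wz_kernel_def by (simp only: power_mult_distrib power_divide) (simp add: mult_ac)
qed

lemma wz_kernel_Suc_left:
  "wz_kernel (Suc n) k = wz_kernel n k * ((real k + real n + 1/2)^2 * (2 * real n + 1)^3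
      / (32 * (real n + 1) * (real k + 1 + 2 * real n)^2 * (real k + 2 + 2 * real n)^2))"
proof -
  define A D where "A = real k + real n + 1/2" and "D = real k + 1 + 2 * real n"
  define m where "m = 2 * real n + 1"
  have pos: "D > 0" "m > 0"
    by (simp_all add: D_def m_def)
  have p1: "pochhammer (1/2::real) (Suc n + k) = pochhammer (1/2) (n + k) * A"
    by (simp add: pochhammer_Suc A_def algebra_simps)
  have p2: "pochhammer (1/2::real) (Suc n) = pochhammer (1/2) n * (m / 2)"
    by (simp add: pochhammer_Suc m_def algebra_simps)
  have f1: "(fact (k + 2 * Suc n) :: real) = fact (k + 2 * n) * (D * (D + 1))"
    by (simp add: D_def algebra_simps)
  have f2: "(fact (2 * Suc n) :: real) = fact (2 * n) * (m * (m + 1))"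
    by (simp add: m_def algebra_simps)
  have "wz_kernel (Suc n) k
      = (pochhammer (1/2) (n + k) * A / (fact (k + 2 * n) * (D * (D + 1))))^2
          * (pochhammer (1/2) n * (m / 2))^4 / (fact (2 * n) * (m * (m + 1)))"
    unfolding wz_kernel_def by (simp only: p1 p2 f1 f2)
  also have "\<dots> = wz_kernel n k * (A^2 / (D * (D + 1))^2 * ((m / 2)^4 / (m * (m + 1))))"
    unfolding wz_kernel_def by (simp only: power_mult_distrib power_divide) (simp add: mult_ac)
  also have "A^2 / (D * (D + 1))^2 * ((m / 2)^4 / (m * (m + 1)))
               = A^2 * m^3 / (16 * (m + 1) * D^2 * (D + 1)^2)"
  proof -
    have "A^2 / (D * E)^2 * ((m / 2)^4 / (m * M)) = A^2 * m^3 / (16 * M * D^2 * E^2)"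
      if "E > 0" "M > 0" for E M
      using pos that by (simp add: field_simps power_numeral_reduce)
    thus ?thesis
      using pos by simp
  qed
  finally show ?thesis
    by (simp add: A_def D_def m_def algebra_simps)
qed

text \<open>Divided by the kernel, the Wilf-Zeilberger equation is an identity of rational functions;
  clearing the common denominator \<open>D^2 (D + 1)^2\<close> makes it polynomial.\<close>

lemma wz_pair:
  "wz_term n (Suc k) - wz_term n k
     = 32 * real (Suc n) * wz_kernel (Suc n) k - 32 * real n * wz_kernel n k"
proof -
  define A D where "A = real k + real n + 1/2" and "D = real k + 1 + 2 * real n"
  have D: "D > 0"
    by (simp add: D_def)
  have ident: "A^2 * wz_poly n (real k + 1) - wz_poly n k * (D + 1)^2
                 = A^2 * (2 * real n + 1)^3 - 32 * real n * (D^2 * (D + 1)^2)"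
    by (simp add: A_def D_def wz_poly_def algebra_simps power2_eq_square power3_eq_cube)
  have "wz_term n (Suc k) - wz_term n k
      = wz_kernel n k * ((A / D)^2 * wz_poly n (real k + 1) / (D + 1)^2 - wz_poly n k / D^2)"
    unfolding wz_term_def wz_kernel_Suc_right by (simp add: A_def D_def algebra_simps)
  also have "(A / D)^2 * wz_poly n (real k + 1) / (D + 1)^2 - wz_poly n k / D^2
      = (A^2 * wz_poly n (real k + 1) - wz_poly n k * (D + 1)^2) / (D^2 * (D + 1)^2)"
    using D by (simp add: power_divide diff_divide_distrib)
  also have "\<dots> = A^2 * (2 * real n + 1)^3 / (D^2 * (D + 1)^2) - 32 * real n"
    unfolding ident using D by (simp add: diff_divide_distrib)
  also have "wz_kernel n k * \<dots>
      = 32 * real (Suc n) * (wz_kernel n k * (A^2 * (2 * real n + 1)^3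
           / (32 * (real n + 1) * D^2 * (D + 1)^2))) - 32 * real n * wz_kernel n k"
  proof -
    have "32 * q * (h * (x / (32 * q * y * z))) = h * (x / (y * z))" if "q > 0" for q h x y z :: real
      using that by simp
    from this[of "real n + 1"] show ?thesis
      by (simp add: right_diff_distrib add.commute mult.commute mult.left_commute)
  qed
  also have "wz_kernel n k * (A^2 * (2 * real n + 1)^3 / (32 * (real n + 1) * D^2 * (D + 1)^2))
      = wz_kernel (Suc n) k"
    unfolding wz_kernel_Suc_left by (simp add: A_def D_def algebra_simps)
  finally show ?thesis .
qed

lemma wz_kernel_0_le: "wz_kernel 0 k \<le> 1"
proof (induction k)
  case 0
  show ?case by (simp add: wz_kernel_def)
next
  case (Suc k)
  have "((real k + 1/2) / (real k + 1))^2 \<le> 1"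
    by (intro power_le_one) (auto simp: field_simps)
  with Suc show ?case
    using mult_mono[OF Suc.IH, of "((real k + 1/2) / (real k + 1))^2" 1]
    by (simp add: wz_kernel_Suc_right)
qed

text \<open>The ratio of consecutive kernel values is at most \<open>1/16\<close>, and the first of these ratios
  contributes the factor \<open>(k + 2)^(-2)\<close>.\<close>

lemma wz_kernel_le:
  assumes "n \<ge> 1"
  shows "wz_kernel n k \<le> (1/16)^n / (real k + 2)^2"
  using assms
proof (induction n rule: dec_induct)
  case base
  have "wz_kernel 1 k = wz_kernel 0 k * ((real k + 1/2)^2 / (real k + 1)^2)
                          / (32 * (real k + 2)^2)"
    using wz_kernel_Suc_left[of 0 k] by (simp add: mult_ac)
  also have "\<dots> \<le> 1 * 1 / (32 * (real k + 2)^2)"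
    by (intro divide_right_mono mult_mono wz_kernel_0_le) (auto intro!: power_mono)
  also have "\<dots> \<le> (1/16)^1 / (real k + 2)^2"
    by (simp add: field_simps)
  finally show ?case .
next
  case (step n)
  define A D m where "A = real k + real n + 1/2" and "D = real k + 1 + 2 * real n"
    and "m = 2 * real n + 1"
  have "A^2 * m^2 * m \<le> D^2 * (D + 1)^2 * (m + 1)"
    by (intro mult_mono power_mono) (auto simp: A_def D_def m_def)
  hence "A^2 * m^3 \<le> (1/16) * (16 * (m + 1) * D^2 * (D + 1)^2)"
    by (simp add: power3_eq_cube power2_eq_square mult_ac del: distrib_left_numeral distrib_right_numeral)
  moreover have "16 * (m + 1) * D^2 * (D + 1)^2 > 0"
    by (simp add: D_def m_def)
  ultimately have ratio: "A^2 * m^3 / (16 * (m + 1) * D^2 * (D + 1)^2) \<le> 1/16"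
    by (subst pos_divide_le_eq) auto
  have "wz_kernel (Suc n) k = wz_kernel n k * (A^2 * m^3 / (16 * (m + 1) * D^2 * (D + 1)^2))"
    unfolding wz_kernel_Suc_left by (simp add: A_def D_def m_def algebra_simps)
  also have "\<dots> \<le> (1/16)^n / (real k + 2)^2 * (1/16)"
    using ratio step.IH wz_kernel_pos[of n k]
    by (intro mult_mono) (auto simp: m_def)
  finally show ?case by simp
qed

lemma wz_poly_le:
  assumes "n \<ge> 0" "k \<ge> 0"
  shows "wz_poly n k \<le> 168 * (k + n + 1)^3"
proof -
  have "168 * (k + n + 1)^3 - wz_poly n k
     = 152 * k^3 + 468 * k^2 + 480 * k + 163 + n * (400 * k^2 + 848 * k + 442)
         + n^2 * (280 * k + 316)"
    by (simp add: wz_poly_def algebra_simps power2_eq_square power3_eq_cube)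
  also have "\<dots> \<ge> 0"
    using assms by simp
  finally show ?thesis by simp
qed

lemma wz_term_nonneg: "wz_term n k \<ge> 0"
  using wz_kernel_pos[of n k] by (simp add: wz_term_def wz_poly_def)

lemma wz_term_le:
  assumes "n \<ge> 1"
  shows "wz_term n k \<le> 168 * (1/8)^n / (real k + 1)"
proof -
  define s where "s = real k + real n + 1"
  have s: "s > 0" by (simp add: s_def)
  have "s^2 \<le> (real k + 1 + 2 * real n)^2"
    by (intro power_mono) (auto simp: s_def)
  moreover have "wz_poly n k \<le> 168 * s^3"
    unfolding s_def by (rule wz_poly_le) auto
  ultimately have "wz_poly n k / (real k + 1 + 2 * real n)^2 \<le> 168 * s^3 / s^2"
    using s by (intro frac_le) auto
  also have "\<dots> = 168 * s"
    using s by (simp add: power2_eq_square power3_eq_cube)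
  finally have "wz_term n k \<le> wz_kernel n k * (168 * s)"
    using wz_kernel_pos[of n k] by (simp add: wz_term_def mult_left_mono flip: times_divide_eq_right)
  also have "\<dots> \<le> ((1/16)^n / (real k + 2)^2) * (168 * (2^n * (real k + 2)))"
  proof (intro mult_mono wz_kernel_le assms)
    have "real n + 1 \<le> 2^n"
      using Bernoulli_inequality[of "1 :: real" n] by simp
    moreover have "s \<le> (real n + 1) * (real k + 2)"
      by (simp add: s_def algebra_simps)
    ultimately show "s \<le> 2^n * (real k + 2)"
      using mult_right_mono[of "real n + 1" "2^n" "real k + 2"] by linarith
  qed (use s in auto)
  also have "\<dots> = 168 * ((1/16)^n * 2^n) / (real k + 2)"
    by (simp add: power2_eq_square)
  also have "(1/16)^n * 2^n = (1/8 :: real)^n"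
    by (simp flip: power_mult_distrib)
  also have "168 * (1/8)^n / (real k + 2) \<le> 168 * (1/8)^n / (real k + 1)"
    by (intro divide_left_mono) auto
  finally show ?thesis .
qed

lemma summable_wz_term: "summable (\<lambda>n. wz_term n k)"
proof (rule summable_comparison_test)
  show "\<exists>N. \<forall>n\<ge>N. norm (wz_term n k) \<le> 168 * (1/8)^n / (real k + 1)"
    by (rule exI[of _ 1]) (use wz_term_le[of _ k] wz_term_nonneg in auto)
qed (intro summable_divide summable_mult summable_geometric; simp)

lemma suminf_wz_term_Suc: "(\<Sum>n. wz_term n (Suc k)) = (\<Sum>n. wz_term n k)"
proof -
  define F where "F = (\<lambda>n. 32 * real n * wz_kernel n k)"
  have F_lim: "F \<longlonglongrightarrow> 0"
  proof (rule tendsto_sandwich[OF _ _ tendsto_const])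
    show "eventually (\<lambda>n. 0 \<le> F n) sequentially"
      using wz_kernel_pos[of _ k] by (simp add: F_def less_imp_le)
    show "(\<lambda>n. 32 * (real n * (1/16)^n)) \<longlonglongrightarrow> 0"
      by (intro tendsto_mult_right_zero powser_times_n_limit_0) auto
    show "eventually (\<lambda>n. F n \<le> 32 * (real n * (1/16)^n)) sequentially"
      using eventually_ge_at_top[of 1]
    proof eventually_elim
      case (elim n)
      have "wz_kernel n k \<le> (1/16)^n / (real k + 2)^2"
        by (rule wz_kernel_le) fact
      also have "\<dots> \<le> (1/16)^n / 1"
        by (intro divide_left_mono) (auto intro!: one_le_power)
      finally show ?case
        by (simp add: F_def mult_left_mono)
    qed
  qed
  have "(\<lambda>n. F (Suc n) - F n) sums (0 - F 0)"
    by (rule telescope_sums[OF F_lim])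
  hence "(\<lambda>n. wz_term n (Suc k) - wz_term n k) sums 0"
    by (simp add: F_def wz_pair)
  moreover have "(\<lambda>n. wz_term n (Suc k) - wz_term n k)
      sums ((\<Sum>n. wz_term n (Suc k)) - (\<Sum>n. wz_term n k))"
    by (intro sums_diff summable_sums summable_wz_term)
  ultimately show ?thesis
    using sums_unique2 by fastforce
qed

lemma suminf_wz_term_const: "(\<Sum>n. wz_term n k) = (\<Sum>n. wz_term n 0)"
  by (induction k) (simp_all add: suminf_wz_term_Suc)

text \<open>This is Euler's limit formula for \<open>1 / \<Gamma>(1/2) = 1 / sqrt \<pi>\<close>, squared, and also Wallis'
  product, since \<open>pochhammer (1/2) k / fact k\<close> is the central binomial coefficient over \<open>4^k\<close>.\<close>

lemma pochhammer_half_asymp: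
  "(\<lambda>k. real k * (pochhammer (1/2) k / fact k)^2) \<longlonglongrightarrow> 1 / pi"
proof -
  have "(\<lambda>k. rGamma_series (1/2::real) k ^ 2 * (real k / (real k + 1/2))^2)
          \<longlonglongrightarrow> rGamma (1/2) ^ 2 * 1^2"
  proof (intro tendsto_mult tendsto_power rGamma_series_LIMSEQ)
    show "(\<lambda>k. real k / (real k + 1/2)) \<longlonglongrightarrow> 1" by real_asymp
  qed
  also have "rGamma (1/2::real) ^ 2 * 1^2 = 1 / pi"
    by (simp add: rGamma_inverse_Gamma Gamma_one_half_real inverse_eq_divide power_divide)
  finally show ?thesis
  proof (rule Lim_transform_eventually)
    show "\<forall>\<^sub>F k in sequentially. rGamma_series (1/2) k ^ 2 * (real k / (real k + 1/2))^2
                                  = real k * (pochhammer (1/2) k / fact k)^2"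
      using eventually_gt_at_top[of 0]
    proof eventually_elim
      case (elim k)
      define q e where "q = real k + 1/2" and "e = exp (1/2 * ln (real k))"
      have "e ^ 2 = real k"
        using elim by (simp add: e_def flip: exp_double)
      have "rGamma_series (1/2) k = pochhammer (1/2) k / fact k * (q / e)"
        by (simp add: rGamma_series_def pochhammer_Suc q_def e_def add_ac)
      hence "rGamma_series (1/2) k ^ 2 * (real k / q)^2
               = (pochhammer (1/2) k / fact k)^2 * (q^2 / e^2 * (real k ^ 2 / q^2))"
        by (simp only: power_mult_distrib power_divide mult.assoc)
      also have "q^2 / e^2 * (real k ^ 2 / q^2) = real k"
        unfolding \<open>e ^ 2 = real k\<close> using elim by (simp add: q_def power2_eq_square)
      finally show ?case
        by (simp only: q_def mult.commute)
    qed
  qed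
qed

lemma wz_term_0_tendsto: "(\<lambda>k. wz_term 0 k) \<longlonglongrightarrow> 16 / pi"
proof -
  have "(\<lambda>k. (real k * (pochhammer (1/2) k / fact k)^2)
              * ((16 * real k^3 + 36 * real k^2 + 24 * real k + 5) / (real k * (real k + 1)^2)))
        \<longlonglongrightarrow> 1 / pi * 16"
    by (intro tendsto_mult pochhammer_half_asymp) real_asymp
  hence "(\<lambda>k. (real k * (pochhammer (1/2) k / fact k)^2)
              * ((16 * real k^3 + 36 * real k^2 + 24 * real k + 5) / (real k * (real k + 1)^2)))
        \<longlonglongrightarrow> 16 / pi"
    by simp
  thus ?thesis
  proof (rule Lim_transform_eventually)
    show "\<forall>\<^sub>F k in sequentially. (real k * (pochhammer (1/2) k / fact k)^2)
              * ((16 * real k^3 + 36 * real k^2 + 24 * real k + 5) / (real k * (real k + 1)^2))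
            = wz_term 0 k"
      using eventually_gt_at_top[of 0]
      by eventually_elim (simp add: wz_term_def wz_kernel_def wz_poly_def)
  qed
qed

lemma suminf_wz_term_tendsto: "(\<lambda>k. \<Sum>n. wz_term n k) \<longlonglongrightarrow> 16 / pi"
proof -
  have split: "(\<Sum>n. wz_term n k) = wz_term 0 k + (\<Sum>n. wz_term (Suc n) k)" for k
    using suminf_split_head[OF summable_wz_term[of k]] by simp
  have sm: "summable (\<lambda>n. wz_term (Suc n) k)" for k
    using summable_wz_term[of k] by (subst summable_Suc_iff)
  have "(\<lambda>k. \<Sum>n. wz_term (Suc n) k) \<longlonglongrightarrow> 0"
  proof (rule tendsto_sandwich[OF _ _ tendsto_const])
    show "eventually (\<lambda>k. 0 \<le> (\<Sum>n. wz_term (Suc n) k)) sequentially"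
      by (intro always_eventually allI suminf_nonneg sm wz_term_nonneg)
    have geo: "(\<lambda>n. 21 / (real k + 1) * (1/8)^n) sums (21 / (real k + 1) * (1 / (1 - 1/8)))"
      for k
      by (intro sums_mult geometric_sums) auto
    show "eventually (\<lambda>k. (\<Sum>n. wz_term (Suc n) k) \<le> 21 / (real k + 1) * (1 / (1 - 1/8)))
            sequentially"
    proof (intro always_eventually allI)
      fix k
      have "(\<Sum>n. wz_term (Suc n) k) \<le> (\<Sum>n. 21 / (real k + 1) * (1/8)^n)"
        by (intro suminf_le sm sums_summable[OF geo])
           (use wz_term_le[of "Suc _" k] in \<open>simp add: field_simps\<close>)
      also have "\<dots> = 21 / (real k + 1) * (1 / (1 - 1/8))"
        by (rule sums_unique[OF geo, symmetric])
      finally show "(\<Sum>n. wz_term (Suc n) k) \<le> 21 / (real k + 1) * (1 / (1 - 1/8))" .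
    qed
    show "(\<lambda>k. 21 / (real k + 1) * (1 / (1 - 1/8))) \<longlonglongrightarrow> 0"
      by real_asymp
  qed
  from tendsto_add[OF wz_term_0_tendsto this] show ?thesis
    by (simp add: split)
qed

lemma wz_term_right_0:
  "wz_term n 0 = fact (2 * n) ^ 3 / fact n ^ 6 * ((5 + 7 * 6 * real n) / 64 ^ (2 * n))"
proof -
  have "(fact (2 * n) :: real) = 4^n * pochhammer (1/2) n * fact n"
    using fact_double[of n, where ?'a = real] by (simp add: power_mult)
  hence half: "pochhammer (1/2 :: real) n = fact (2 * n) / (4^n * fact n)"
    by simp
  have "wz_kernel n 0 = fact (2 * n) ^ 3 / (fact n ^ 6 * (4^n) ^ 6)"
    unfolding wz_kernel_def add_0_right add_0_left half
    by (simp add: power_divide power_mult_distrib) (simp add: field_simps power_numeral_reduce)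
  also have "(4^n) ^ 6 = (64 ^ (2 * n) :: real)"
  proof -
    have "(4^n) ^ 6 = ((4^6) ^ n :: real)" "(64 ^ (2 * n) :: real) = (64^2) ^ n"
      by (simp_all only: mult.commute flip: power_mult)
    thus ?thesis by simp
  qed
  finally have kernel: "wz_kernel n 0 = fact (2 * n) ^ 3 / (fact n ^ 6 * 64 ^ (2 * n))" .
  have "wz_poly n 0 = (5 + 42 * real n) * (2 * real n + 1)^2"
    by (simp add: wz_poly_def algebra_simps power2_eq_square power3_eq_cube)
  moreover have "2 * real n + 1 > 0"
    by simp
  ultimately have "wz_poly n 0 / (1 + 2 * real n)^2 = 5 + 42 * real n"
    by (simp add: add.commute)
  moreover have "wz_term n 0 = wz_kernel n 0 * (wz_poly n 0 / (1 + 2 * real n)^2)"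
    by (simp add: wz_term_def)
  ultimately show ?thesis
    by (simp add: kernel)
qed

theorem mainTheorem2:
  shows "summable (\<lambda>n::nat. (fact (2 * n) :: real) ^ 3 / (fact n :: real) ^ 6
            * ((5 + 7 * 6 * real n) / 64 ^ (2 * n)))
    \<and> 1 / pi = 1 / 16 * (\<Sum>n::nat. (fact (2 * n) :: real) ^ 3 / (fact n :: real) ^ 6
            * ((5 + 7 * 6 * real n) / 64 ^ (2 * n)))"
proof -
  have "(\<lambda>k::nat. \<Sum>n. wz_term n 0) \<longlonglongrightarrow> 16 / pi"
    using suminf_wz_term_tendsto by (subst (asm) suminf_wz_term_const)
  hence "(\<Sum>n. wz_term n 0) = 16 / pi"
    using LIMSEQ_unique[OF tendsto_const] by blast
  with summable_wz_term[of 0] show ?thesis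
    unfolding wz_term_right_0 by simp
qed

end
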